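(* Let $M,N\ge 2$ and let $A$ be a Hermitian operator on $\mathbb{C}^M\otimes\mathbb{C}^N$ with spectral decomposition $A=\sum_{i=0}^{MN-1}\lambda_i|\lambda_i\rangle\langle\lambda_i|$, where $\lambda_0\le\cdots\le\lambda_{MN-1}$. Then $A$ is a left or right entanglement witness if and only if at least one of the following holds: (i) there exists $k\in\{0,1,\ldots,MN-2\}$ such that $\mathrm{span}\{|\lambda_0\rangle,\ldots,|\lambda_k\rangle\}$ contains no separable pure state and $\lambda_{k+1}>\lambda_k$; (ii) there exists $l\in\{1,2,\ldots,MN-1\}$ such that $\mathrm{span}\{|\lambda_l\rangle,|\lambda_{l+1}\rangle,\ldots,|\lambda_{MN-1}\rangle\}$ contains no separable pure state and $\lambda_l>\lambda_{l-1}$.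
   Context: For a Hermitian operator $A$ and $a\in\mathbb{R}$, let $H^\circ_{A,a}=\{x \text{ Hermitian}:\ \mathrm{tr}(Ax)<a\}$. Then $H^\circ_{-A,-b}=\{x:\mathrm{tr}(Ax)>b\}$. Let $\mathcal{S}_{M,N}$ be the set of separable density operators on $\mathbb{C}^M\otimes\mathbb{C}^N$, i.e. convex combinations of product states $\rho^A\otimes\rho^B$. Let $\mathcal{E}_{M,N}$ be the set of density operators that are not separable. The operator $A$ is a left witness if there exists $a$ with $\mathcal{S}_{M,N}\cap H^\circ_{A,a}=\varnothing$ and $\mathcal{E}_{M,N}\cap H^\circ_{A,a}\neq\varnothing$. It is a right witness if there exists $b$ with $\mathcal{S}_{M,N}\cap H^\circ_{-A,-b}=\varnothing$ and $\mathcal{E}_{M,N}\cap H^\circ_{-A,-b}\neq\varnothing$. A separable pure state is a unit product vector $|\psi^A\rangle\otimes|\psi^B\rangle$. *)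

theory Defs
  imports "HOL-Analysis.Analysis"
begin

text \<open>
  The space \<open>\<complex>\<^sup>M \<otimes> \<complex>\<^sup>N\<close> is rendered as \<open>complex ^ ('m \<times> 'n)\<close> with \<open>M = CARD('m)\<close> and
  \<open>N = CARD('n)\<close>, and operators as square matrices in the standard (product) basis.
\<close>

text \<open>
  The library's inner product on \<open>complex ^ 'n\<close> is the real one (the real part of the following).
  Physics convention: antilinear in the first argument.
\<close>
definition cinner :: "complex ^ 'n \<Rightarrow> complex ^ 'n \<Rightarrow> complex" where
  "cinner x y = (\<Sum>i\<in>UNIV. cnj (x $ i) * y $ i)"

definition ketbra :: "complex ^ 'n \<Rightarrow> complex ^ 'n \<Rightarrow> complex ^ 'n ^ 'n" where
  "ketbra x y = (\<chi> i j. x $ i * cnj (y $ j))"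

definition hermitian :: "complex ^ 'n ^ 'n \<Rightarrow> bool" where
  "hermitian A \<longleftrightarrow> (\<forall>i j. A $ i $ j = cnj (A $ j $ i))"

text \<open>For Hermitian \<open>A\<close> the quadratic form is real, so taking \<open>Re\<close> loses nothing.\<close>
definition psd :: "complex ^ 'n ^ 'n \<Rightarrow> bool" where
  "psd A \<longleftrightarrow> hermitian A \<and> (\<forall>x. 0 \<le> Re (cinner x (A *v x)))"

definition density_operator :: "complex ^ 'n ^ 'n \<Rightarrow> bool" where
  "density_operator \<rho> \<longleftrightarrow> psd \<rho> \<and> trace \<rho> = 1"

definition tensor_vec ::
  "complex ^ 'm \<Rightarrow> complex ^ 'n \<Rightarrow> complex ^ ('m::finite \<times> 'n::finite)" where
  "tensor_vec x y = (\<chi> p. x $ fst p * y $ snd p)"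

definition tensor_op ::
  "complex ^ 'm ^ 'm \<Rightarrow> complex ^ 'n ^ 'n
    \<Rightarrow> complex ^ ('m::finite \<times> 'n::finite) ^ ('m \<times> 'n)" where
  "tensor_op X Y = (\<chi> p q. X $ fst p $ fst q * Y $ snd p $ snd q)"

definition separable_states :: "(complex ^ ('m::finite \<times> 'n::finite) ^ ('m \<times> 'n)) set" where
  "separable_states =
     convex hull {tensor_op \<rho> \<sigma> | \<rho> \<sigma>. density_operator \<rho> \<and> density_operator \<sigma>}"

definition entangled_states :: "(complex ^ ('m::finite \<times> 'n::finite) ^ ('m \<times> 'n)) set" where
  "entangled_states = {\<rho>. density_operator \<rho> \<and> \<rho> \<notin> separable_states}"

text \<open>The trace of a product of two Hermitian matrices is real, so taking \<open>Re\<close> loses nothing.\<close>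
definition open_halfspace :: "complex ^ 'n ^ 'n \<Rightarrow> real \<Rightarrow> (complex ^ 'n ^ 'n) set" where
  "open_halfspace A a = {x. hermitian x \<and> Re (trace (A ** x)) < a}"

definition left_witness :: "complex ^ ('m::finite \<times> 'n::finite) ^ ('m \<times> 'n) \<Rightarrow> bool" where
  "left_witness A \<longleftrightarrow>
     (\<exists>a. separable_states \<inter> open_halfspace A a = {} \<and>
          entangled_states \<inter> open_halfspace A a \<noteq> {})"

definition right_witness :: "complex ^ ('m::finite \<times> 'n::finite) ^ ('m \<times> 'n) \<Rightarrow> bool" where
  "right_witness A \<longleftrightarrow>
     (\<exists>b. separable_states \<inter> open_halfspace (- A) (- b) = {} \<and>
          entangled_states \<inter> open_halfspace (- A) (- b) \<noteq> {})"

definition separable_pure_state :: "complex ^ ('m::finite \<times> 'n::finite) \<Rightarrow> bool" where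
  "separable_pure_state \<psi> \<longleftrightarrow> norm \<psi> = 1 \<and> (\<exists>x y. \<psi> = tensor_vec x y)"

text \<open>
  Eigenvalues are repeated according to multiplicity and listed in nondecreasing order; only the
  values of \<open>lam\<close> and \<open>v\<close> at indices below the dimension matter.
\<close>
definition spectral_decomposition ::
  "complex ^ 'n ^ 'n \<Rightarrow> (nat \<Rightarrow> real) \<Rightarrow> (nat \<Rightarrow> complex ^ 'n) \<Rightarrow> bool" where
  "spectral_decomposition A lam v \<longleftrightarrow>
     (\<forall>i<CARD('n). \<forall>j<CARD('n). cinner (v i) (v j) = (if i = j then 1 else 0)) \<and>
     (\<forall>i j. i \<le> j \<and> j < CARD('n) \<longrightarrow> lam i \<le> lam j) \<and>
     A = (\<Sum>i<CARD('n). lam i *\<^sub>R ketbra (v i) (v i))"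

end

theory Submission
  imports Defs
begin

text \<open>
  The spectral decomposition shows that \<open>\<lambda>\<^sub>0\<close> is the minimum of \<open>tr (A \<rho>)\<close> over all density
  operators, attained on \<open>|\<lambda>\<^sub>0\<rangle>\<langle>\<lambda>\<^sub>0|\<close>. Hence \<open>A\<close> is a left witness iff \<open>\<langle>\<psi>|A|\<psi>\<rangle>\<close> is bounded away from
  \<open>\<lambda>\<^sub>0\<close> on the unit product vectors, which by compactness means that the \<open>\<lambda>\<^sub>0\<close>-eigenspace contains
  no such vector. That eigenspace is the smallest of the spans allowed in (i). Right
  witnesses are the left witnesses of \<open>-A\<close>, whose spectral decomposition lists the same
  eigenvectors in reverse.
\<close>

section \<open>The complex inner product and its norm\<close>

lemma cinner_add_left: "cinner (x + y) z = cinner x z + cinner y z"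
  by (simp add: cinner_def sum.distrib algebra_simps)

lemma cinner_add_right: "cinner x (y + z) = cinner x y + cinner x z"
  by (simp add: cinner_def sum.distrib algebra_simps)

lemma cinner_scale_left: "cinner (c *s x) y = cnj c * cinner x y"
  by (simp add: cinner_def sum_distrib_left algebra_simps)

lemma cinner_scale_right: "cinner x (c *s y) = c * cinner x y"
  by (simp add: cinner_def sum_distrib_left algebra_simps)

lemma cinner_zero_right: "cinner x 0 = 0"
  by (simp add: cinner_def)

lemma cinner_commute: "cinner x y = cnj (cinner y x)"
  by (simp add: cinner_def algebra_simps)

lemma cinner_axis_left: "cinner (axis k 1) y = y $ k"
  by (simp add: cinner_def axis_def if_distrib if_distribR cong: if_cong)

lemma matrix_vector_mult_axis: "A *v axis k 1 = column k (A :: complex ^ 'n ^ 'm)"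
  by (simp add: vec_eq_iff matrix_vector_mult_def axis_def column_def if_distrib cong: if_cong)

lemma norm_vec_sq: "(norm (x :: complex ^ 'n))\<^sup>2 = (\<Sum>i\<in>UNIV. (cmod (x $ i))\<^sup>2)"
  by (simp add: norm_vec_def L2_set_def sum_nonneg)

lemma cinner_self: "cinner x x = of_real ((norm x)\<^sup>2)"
  unfolding norm_vec_sq cinner_def of_real_sum
  by (intro sum.cong refl) (simp add: complex_norm_square [symmetric] mult.commute
      del: of_real_power)

lemma norm_scale: "norm (c *s (x :: complex ^ 'n)) = cmod c * norm x"
proof -
  have "(norm (c *s x))\<^sup>2 = (cmod c * norm x)\<^sup>2"
    by (simp add: norm_vec_sq norm_mult power_mult_distrib sum_distrib_left)
  then show ?thesis
    by simp
qed

lemma hermitian_cnj: "hermitian A \<Longrightarrow> cnj (A $ i $ j) = A $ j $ i"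
  unfolding hermitian_def by metis

text \<open>Self-adjointness: exchanging the two sums and conjugating each matrix entry moves
  \<open>A\<close> to the other argument.\<close>

lemma cinner_hermitian:
  assumes "hermitian A"
  shows "cinner x (A *v y) = cnj (cinner y (A *v x))"
proof -
  have "cinner x (A *v y) = (\<Sum>i\<in>UNIV. \<Sum>j\<in>UNIV. cnj (x $ i) * (A $ i $ j * y $ j))"
    by (simp add: cinner_def matrix_vector_mult_def sum_distrib_left)
  also have "\<dots> = (\<Sum>j\<in>UNIV. \<Sum>i\<in>UNIV. cnj (x $ i) * (A $ i $ j * y $ j))"
    by (rule sum.swap)
  also have "\<dots> = (\<Sum>j\<in>UNIV. \<Sum>i\<in>UNIV. y $ j * (cnj (A $ j $ i) * cnj (x $ i)))"
  proof (intro sum.cong refl)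
    fix i j
    have "A $ i $ j = cnj (A $ j $ i)"
      using assms unfolding hermitian_def by blast
    then show "cnj (x $ i) * (A $ i $ j * y $ j) = y $ j * (cnj (A $ j $ i) * cnj (x $ i))"
      by (simp only: mult_ac)
  qed
  also have "\<dots> = cnj (cinner y (A *v x))"
    by (simp add: cinner_def matrix_vector_mult_def sum_distrib_left)
  finally show ?thesis .
qed

section \<open>Quadratic forms\<close>

definition expectation :: "complex ^ 'n ^ 'n \<Rightarrow> complex ^ 'n \<Rightarrow> real" where
  "expectation A x = Re (cinner x (A *v x))"

lemma trace_mult_ketbra: "trace (A ** ketbra x x) = cinner x (A *v x)"
  by (simp add: trace_def matrix_matrix_mult_def ketbra_def cinner_def matrix_vector_mult_def
      sum_distrib_left mult_ac)

lemma ketbra_vector_mult: "ketbra x y *v z = cinner y z *s x"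
  by (simp add: vec_eq_iff ketbra_def cinner_def matrix_vector_mult_def sum_distrib_left
      sum_distrib_right mult_ac)

lemma expectation_ketbra: "expectation (ketbra w w) x = (cmod (cinner w x))\<^sup>2"
proof -
  have "cinner x (ketbra w w *v x) = cinner w x * cnj (cinner w x)"
    by (simp add: ketbra_vector_mult cinner_scale_right cinner_commute [of x w])
  then show ?thesis
    by (simp add: expectation_def complex_norm_square [symmetric] del: of_real_power)
qed

lemma expectation_add: "expectation (A + B) x = expectation A x + expectation B x"
  by (simp add: expectation_def matrix_vector_mult_add_rdistrib cinner_add_right)

lemma expectation_scaleR: "expectation (c *\<^sub>R A) x = c * expectation A x"
  by (simp add: expectation_def cinner_def matrix_vector_mult_def sum_distrib_left mult_ac)

lemma expectation_diff: "expectation (A - B) x = expectation A x - expectation B x"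
  using expectation_add [of "A - B" B x] by simp

lemma expectation_zero: "expectation 0 x = 0"
  by (simp add: expectation_def cinner_zero_right)

lemma expectation_sum: "expectation (\<Sum>i\<in>I. A i) x = (\<Sum>i\<in>I. expectation (A i) x)"
  by (induction I rule: infinite_finite_induct) (simp_all add: expectation_zero expectation_add)

lemma expectation_scale_vec: "expectation A (c *s x) = (cmod c)\<^sup>2 * expectation A x"
proof -
  have "cinner (c *s x) (A *v (c *s x)) = (c * cnj c) * cinner x (A *v x)"
    by (simp add: vector_scalar_commute cinner_scale_left cinner_scale_right mult_ac)
  then show ?thesis
    by (simp add: expectation_def complex_norm_square [symmetric] del: of_real_power)
qed

text \<open>The two cross terms are conjugate to each other, so they merge into twice a real part.
  Evaluating a positive form at a well-chosen \<open>t\<close> then yields inequalities between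
  matrix entries.\<close>

lemma expectation_add_axis:
  assumes "hermitian A"
  shows "expectation A (x + t *s axis k 1) =
    expectation A x + 2 * Re (cnj t * (A *v x) $ k) + (cmod t)\<^sup>2 * Re (A $ k $ k)"
proof -
  let ?e = "axis k 1 :: complex ^ 'a"
  have "expectation A (x + t *s ?e) = expectation A x + expectation A (t *s ?e) +
      Re (cinner x (A *v (t *s ?e))) + Re (cinner (t *s ?e) (A *v x))"
    by (simp add: expectation_def matrix_vector_right_distrib cinner_add_left cinner_add_right)
  moreover have "Re (cinner x (A *v (t *s ?e))) = Re (cinner (t *s ?e) (A *v x))"
    using cinner_hermitian [OF assms, of x "t *s ?e"] by simp
  moreover have "cinner (t *s ?e) (A *v x) = cnj t * (A *v x) $ k"
    by (simp add: cinner_scale_left cinner_axis_left)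
  moreover have "expectation A ?e = Re (A $ k $ k)"
    by (simp add: expectation_def cinner_axis_left matrix_vector_mult_axis column_def)
  ultimately show ?thesis
    by (simp add: expectation_scale_vec)
qed

section \<open>Positive semidefinite matrices as sums of rank-one terms\<close>

lemma hermitian_ketbra: "hermitian (ketbra x x)"
  by (simp add: hermitian_def ketbra_def)

lemma trace_ketbra: "trace (ketbra x x) = of_real ((norm x)\<^sup>2)"
  by (simp add: trace_def ketbra_def cinner_self [symmetric] cinner_def mult.commute
      del: of_real_power)

lemma psd_ketbra: "psd (ketbra x x)"
  using expectation_ketbra [of x] by (simp add: psd_def hermitian_ketbra expectation_def)

lemma density_operator_ketbra: "norm x = 1 \<Longrightarrow> density_operator (ketbra x x)"
  by (simp add: density_operator_def psd_ketbra trace_ketbra)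

lemma psd_diagonal_nonneg: "psd A \<Longrightarrow> 0 \<le> Re (A $ k $ k)"
  by (metis psd_def cinner_axis_left matrix_vector_mult_axis column_def vec_lambda_beta)

lemma hermitian_diagonal: "hermitian A \<Longrightarrow> A $ k $ k = of_real (Re (A $ k $ k))"
  by (metis hermitian_def Reals_cnj_iff of_real_Re)

text \<open>When the diagonal vanishes, the form on the span of two axis vectors consists of the
  cross term alone. The coefficient minus the off-diagonal entry makes that term negative unless the
  entry is zero.\<close>

lemma psd_zero_diagonal:
  assumes "psd A" and diag: "\<And>k. A $ k $ k = 0"
  shows "A = 0"
proof -
  have herm: "hermitian A"
    using assms(1) by (simp add: psd_def)
  have "A $ k $ j = 0" for j k
  proof -
    let ?z = "A $ k $ j"
    have col: "(A *v axis j 1) $ k = ?z"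
      by (simp add: matrix_vector_mult_axis column_def)
    have "expectation A (axis j 1) = 0"
      by (simp add: expectation_def cinner_axis_left matrix_vector_mult_axis column_def diag)
    then have "expectation A (axis j 1 + (- ?z) *s axis k 1) = 2 * Re (cnj (- ?z) * ?z)"
      by (simp only: expectation_add_axis [OF herm] col diag) simp
    also have "\<dots> = - 2 * (cmod ?z)\<^sup>2"
      by (simp add: cmod_power2) (simp add: power2_eq_square)
    finally have "expectation A (axis j 1 + (- ?z) *s axis k 1) = - 2 * (cmod ?z)\<^sup>2" .
    moreover have "0 \<le> expectation A (axis j 1 + (- ?z) *s axis k 1)"
      using assms(1) by (simp add: psd_def expectation_def)
    ultimately show ?thesis
      by simp
  qed
  then show ?thesis
    by (simp add: vec_eq_iff)
qed

text \<open>One step of the Cholesky decomposition, eliminating the \<open>k\<close>-th row and column.\<close>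

lemma psd_schur_step:
  assumes "psd A" and nz: "A $ k $ k \<noteq> 0"
  obtains w where "psd (A - ketbra w w)" and "(A - ketbra w w) $ k $ k = 0"
proof -
  have herm: "hermitian A"
    using assms(1) by (simp add: psd_def)
  define d where "d = Re (A $ k $ k)"
  have Ad: "A $ k $ k = of_real d"
    using hermitian_diagonal [OF herm] by (simp add: d_def)
  have "d \<noteq> 0"
    using nz Ad by auto
  moreover have "d \<ge> 0"
    unfolding d_def by (rule psd_diagonal_nonneg [OF assms(1)])
  ultimately have d: "d > 0"
    by simp
  \<comment> \<open>This is the Cholesky column: \<open>ketbra w w\<close> has the same
    \<open>k\<close>-th row and column as \<open>A\<close>, so subtracting it clears both.\<close>
  define w where "w = of_real (1 / sqrt d) *s column k A"
  have coeff: "cinner w x = of_real (1 / sqrt d) * (A *v x) $ k" for x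
  proof -
    have "cinner (column k A) x = (A *v x) $ k"
      by (simp add: cinner_def column_def matrix_vector_mult_def hermitian_cnj [OF herm])
    then show ?thesis
      by (simp add: w_def cinner_scale_left)
  qed
  have "0 \<le> expectation (A - ketbra w w) x" for x
  proof -
    define z where "z = (A *v x) $ k"
    \<comment> \<open>The minimiser of the quadratic
      \<open>2 * Re (cnj t * z) + (cmod t)\<^sup>2 * d\<close>. Nonnegativity at this point is the
      Cauchy-Schwarz inequality for the form of \<open>A\<close> against the \<open>k\<close>-th
      axis vector.\<close>
    define t where "t = - z / of_real d"
    have "0 \<le> expectation A (x + t *s axis k 1)"
      using assms(1) by (simp add: psd_def expectation_def)
    also have "\<dots> = expectation A x + 2 * Re (cnj t * z) + (cmod t)\<^sup>2 * d"
      by (simp add: expectation_add_axis [OF herm] z_def d_def)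
    also have "Re (cnj t * z) = - (cmod z)\<^sup>2 / d"
      using d unfolding cmod_power2 by (simp add: t_def power2_eq_square field_simps)
    also have "(cmod t)\<^sup>2 * d = (cmod z)\<^sup>2 / d"
      using d by (simp add: t_def norm_divide power_divide power2_eq_square)
    finally have "(cmod z)\<^sup>2 / d \<le> expectation A x"
      by simp
    moreover have "expectation (ketbra w w) x = (cmod z)\<^sup>2 / d"
      using d by (simp add: expectation_ketbra coeff z_def norm_mult norm_divide power_divide)
    ultimately show ?thesis
      by (simp add: expectation_diff)
  qed
  moreover have "hermitian (A - ketbra w w)"
    unfolding hermitian_def by (simp add: ketbra_def hermitian_cnj [OF herm])
  ultimately have "psd (A - ketbra w w)"
    by (simp add: psd_def expectation_def)
  moreover have "(A - ketbra w w) $ k $ k = 0"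
  proof -
    have "w $ k = of_real (1 / sqrt d * d)"
      by (simp add: w_def column_def Ad)
    also have "1 / sqrt d * d = sqrt d"
      using d by (simp add: real_div_sqrt)
    finally have "w $ k = of_real (sqrt d)" .
    then show ?thesis
      using d by (simp add: ketbra_def Ad flip: of_real_mult)
  qed
  ultimately show ?thesis
    using that by blast
qed

text \<open>Induction on the number of nonzero diagonal entries: each elimination step clears one
  and revives none. The vectors are neither orthogonal nor normalised in general; all that matters
  later is that their squared norms add up to the trace.\<close>

lemma psd_sum_ketbra:
  assumes "psd A"
  obtains n :: nat and w where "A = (\<Sum>i<n. ketbra (w i) (w i))"
proof -
  have "\<exists>(n::nat) w. A = (\<Sum>i<n. ketbra (w i) (w i))"
    using assms
  proof (induction "card {k. A $ k $ k \<noteq> 0}" arbitrary: A rule: less_induct)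
    case less
    show ?case
    proof (cases "\<forall>k. A $ k $ k = 0")
      case True
      then have "A = (\<Sum>i<(0::nat). ketbra (undefined i) (undefined i))"
        using psd_zero_diagonal [OF less.prems] by simp
      then show ?thesis
        by blast
    next
      case False
      then obtain k where k: "A $ k $ k \<noteq> 0"
        by blast
      obtain u where u: "psd (A - ketbra u u)" "(A - ketbra u u) $ k $ k = 0"
        using psd_schur_step [OF less.prems k] .
      let ?B = "A - ketbra u u"
      \<comment> \<open>At a zero diagonal entry of \<open>A\<close>, subtracting the nonnegative
        entry of \<open>ketbra u u\<close> cannot give a positive value, and positivity of
        \<open>?B\<close> excludes a negative one.\<close>
      have "?B $ l $ l = 0" if "A $ l $ l = 0" for l
      proof -
        have "Re (ketbra u u $ l $ l) \<ge> 0"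
          using psd_diagonal_nonneg [OF psd_ketbra] .
        moreover have "Re (?B $ l $ l) \<ge> 0"
          using psd_diagonal_nonneg [OF u(1)] .
        ultimately have "Re (?B $ l $ l) = 0"
          using that by simp
        then show ?thesis
          using hermitian_diagonal [of ?B l] u(1) by (simp add: psd_def)
      qed
      then have "{l. ?B $ l $ l \<noteq> 0} \<subset> {l. A $ l $ l \<noteq> 0}"
        using u(2) k by blast
      then have "card {l. ?B $ l $ l \<noteq> 0} < card {l. A $ l $ l \<noteq> 0}"
        by (intro psubset_card_mono) auto
      from less.hyps [OF this u(1)] obtain n :: nat and w
        where "?B = (\<Sum>i<n. ketbra (w i) (w i))"
        by blast
      \<comment> \<open>The eliminated vector is appended at index \<open>n\<close>, outside the
        range of the sum for \<open>?B\<close>.\<close>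
      then have "A = (\<Sum>i<Suc n. ketbra ((w(n := u)) i) ((w(n := u)) i))"
        by (simp add: algebra_simps)
      then show ?thesis
        by blast
    qed
  qed
  then show ?thesis
    using that by blast
qed

section \<open>Product vectors and separable pure states\<close>

lemma norm_tensor_vec: "norm (tensor_vec x y) = norm x * norm y"
proof -
  have "(norm (tensor_vec x y))\<^sup>2 = (norm x * norm y)\<^sup>2"
    by (simp add: norm_vec_sq tensor_vec_def norm_mult power_mult_distrib sum_product
        sum.cartesian_product case_prod_beta)
  then show ?thesis
    by simp
qed

lemma tensor_vec_scale: "tensor_vec (c *s x) (d *s y) = (c * d) *s tensor_vec x y"
  by (simp add: vec_eq_iff tensor_vec_def)

lemma ketbra_tensor_vec:
  "ketbra (tensor_vec x y) (tensor_vec x y) = tensor_op (ketbra x x) (ketbra y y)"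
  by (simp add: vec_eq_iff ketbra_def tensor_vec_def tensor_op_def)

lemma tensor_op_sum:
  "tensor_op (\<Sum>i\<in>I. X i) (\<Sum>j\<in>J. Y j) = (\<Sum>i\<in>I. \<Sum>j\<in>J. tensor_op (X i) (Y j))"
  by (simp add: vec_eq_iff tensor_op_def sum_product)

text \<open>The expectation is a polynomial in the coordinates and their conjugates. Continuity
  serves to find a minimum over the compact set of pairs of unit vectors.\<close>

lemma continuous_on_tensor_expectation:
  "continuous_on S (\<lambda>p. expectation A (tensor_vec (fst p) (snd p)))"
  unfolding expectation_def cinner_def matrix_vector_mult_def tensor_vec_def
  by (simp, intro continuous_intros)

lemma scale_to_unit:
  fixes x :: "complex ^ 'n"
  assumes "x \<noteq> 0"
  obtains u where "norm u = 1" and "x = of_real (norm x) *s u"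
proof
  show "norm (of_real (inverse (norm x)) *s x) = 1"
    using assms by (simp add: norm_scale norm_inverse)
  show "x = of_real (norm x) *s (of_real (inverse (norm x)) *s x)"
    using assms by (simp flip: of_real_mult)
qed

text \<open>Only the product of the two norms is known to be 1. After both factors are rescaled to
  unit length, the scalars pulled out multiply to 1 and disappear.\<close>

lemma separable_pure_state_unit_factors:
  assumes "separable_pure_state \<psi>"
  obtains x y where "norm x = 1" and "norm y = 1" and "\<psi> = tensor_vec x y"
proof -
  from assms obtain x y where xy: "norm \<psi> = 1" "\<psi> = tensor_vec x y"
    by (auto simp: separable_pure_state_def)
  then have nn: "norm x * norm y = 1"
    by (simp add: norm_tensor_vec)
  then have nz: "x \<noteq> 0" "y \<noteq> 0"
    by auto
  obtain u where u: "norm u = 1" "x = of_real (norm x) *s u"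
    using scale_to_unit [OF nz(1)] .
  obtain w where w: "norm w = 1" "y = of_real (norm y) *s w"
    using scale_to_unit [OF nz(2)] .
  have "\<psi> = (of_real (norm x) * of_real (norm y)) *s tensor_vec u w"
    unfolding xy(2) tensor_vec_scale [symmetric] using u(2) w(2) by simp
  also have "\<dots> = tensor_vec u w"
    using nn by (simp flip: of_real_mult)
  finally show ?thesis
    using that u w by blast
qed

lemma ketbra_separable_pure_state:
  assumes "separable_pure_state \<psi>"
  shows "ketbra \<psi> \<psi> \<in> separable_states"
proof -
  obtain x y where "norm x = 1" "norm y = 1" "\<psi> = tensor_vec x y"
    using separable_pure_state_unit_factors [OF assms] .
  then have "ketbra \<psi> \<psi> \<in> {tensor_op \<rho> \<sigma> | \<rho> \<sigma>. density_operator \<rho> \<and> density_operator \<sigma>}"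
    by (auto simp only: ketbra_tensor_vec intro: density_operator_ketbra)
  then show ?thesis
    unfolding separable_states_def by (rule hull_inc)
qed

section \<open>Trace bounds on separable states\<close>

lemma trace_sum: "trace (\<Sum>i\<in>I. (X i :: complex ^ 'n ^ 'n)) = (\<Sum>i\<in>I. trace (X i))"
  by (simp add: trace_def) (rule sum.swap)

lemma matrix_mult_sum_right:
  "A ** (\<Sum>i\<in>I. (X i :: complex ^ 'n ^ 'n)) = (\<Sum>i\<in>I. A ** X i)"
  by (induction I rule: infinite_finite_induct) (simp_all add: matrix_add_ldistrib)

lemma trace_mult_sum_ketbra:
  "Re (trace (A ** (\<Sum>i\<in>I. ketbra (w i) (w i)))) = (\<Sum>i\<in>I. expectation A (w i))"
  by (simp add: matrix_mult_sum_right trace_sum trace_mult_ketbra expectation_def)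

text \<open>Rank-one decompositions of both factors reduce a product state to product vectors with
  total weight 1. The bound then passes to convex combinations because a closed half-space is
  convex.\<close>

lemma trace_mult_separable_ge:
  fixes A :: "complex ^ ('m::finite \<times> 'n::finite) ^ ('m \<times> 'n)"
  assumes ge: "\<And>x y. norm x = 1 \<Longrightarrow> norm y = 1 \<Longrightarrow> a \<le> expectation A (tensor_vec x y)"
    and "s \<in> separable_states"
  shows "a \<le> Re (trace (A ** s))"
proof -
  \<comment> \<open>The terms of a rank-one decomposition are not unit vectors and may vanish, so
    the bound is first extended by homogeneity of degree two in each factor.\<close>
  have scaled: "a * ((norm x)\<^sup>2 * (norm y)\<^sup>2) \<le> expectation A (tensor_vec x y)"
    for x :: "complex ^ 'm" and y :: "complex ^ 'n"
  proof (cases "x = 0 \<or> y = 0")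
    case True
    then have "norm (tensor_vec x y) = 0"
      by (auto simp: norm_tensor_vec)
    then have "tensor_vec x y = 0"
      by simp
    then show ?thesis
      using True by (auto simp: expectation_def cinner_zero_right)
  next
    case False
    obtain u where u: "norm u = 1" "x = of_real (norm x) *s u"
      using scale_to_unit False by blast
    obtain w where w: "norm w = 1" "y = of_real (norm y) *s w"
      using scale_to_unit False by blast
    have "tensor_vec x y = (of_real (norm x) * of_real (norm y)) *s tensor_vec u w"
      unfolding tensor_vec_scale [symmetric] using u(2) w(2) by simp
    then have "expectation A (tensor_vec x y) =
        ((norm x)\<^sup>2 * (norm y)\<^sup>2) * expectation A (tensor_vec u w)"
      by (simp add: expectation_scale_vec norm_mult power_mult_distrib)
    then show ?thesis
      using mult_left_mono [OF ge [OF u(1) w(1)], of "(norm x)\<^sup>2 * (norm y)\<^sup>2"]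
      by (simp add: mult.commute)
  qed
  have "{tensor_op \<rho> \<sigma> | \<rho> \<sigma>. density_operator \<rho> \<and> density_operator \<sigma>}
      \<subseteq> {s. a \<le> Re (trace (A ** s))}"
  proof clarify
    fix \<rho> :: "complex ^ 'm ^ 'm" and \<sigma> :: "complex ^ 'n ^ 'n"
    assume dens: "density_operator \<rho>" "density_operator \<sigma>"
    obtain p :: nat and w where \<rho>: "\<rho> = (\<Sum>i<p. ketbra (w i) (w i))"
      using psd_sum_ketbra dens(1) unfolding density_operator_def by blast
    obtain q :: nat and u where \<sigma>: "\<sigma> = (\<Sum>j<q. ketbra (u j) (u j))"
      using psd_sum_ketbra dens(2) unfolding density_operator_def by blast
    have "complex_of_real (\<Sum>i<p. (norm (w i))\<^sup>2) = 1" "complex_of_real (\<Sum>j<q. (norm (u j))\<^sup>2) = 1"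
      using dens by (simp_all add: density_operator_def \<rho> \<sigma> trace_sum trace_ketbra)
    then have unit: "(\<Sum>i<p. (norm (w i))\<^sup>2) = 1" "(\<Sum>j<q. (norm (u j))\<^sup>2) = 1"
      by (simp_all only: of_real_eq_1_iff)
    \<comment> \<open>The two sums are the traces of \<open>\<rho>\<close> and
      \<open>\<sigma>\<close>; multiplied out, they weight the pairs of rank-one terms.\<close>
    have "a = a * ((\<Sum>i<p. (norm (w i))\<^sup>2) * (\<Sum>j<q. (norm (u j))\<^sup>2))"
      by (simp add: unit)
    also have "\<dots> = (\<Sum>i<p. \<Sum>j<q. a * ((norm (w i))\<^sup>2 * (norm (u j))\<^sup>2))"
      by (simp only: sum_product) (simp only: sum_distrib_left)
    also have "\<dots> \<le> (\<Sum>i<p. \<Sum>j<q. expectation A (tensor_vec (w i) (u j)))"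
      by (intro sum_mono scaled)
    also have "\<dots> = Re (trace (A ** tensor_op \<rho> \<sigma>))"
      by (simp add: \<rho> \<sigma> tensor_op_sum ketbra_tensor_vec [symmetric] matrix_mult_sum_right
          trace_sum trace_mult_ketbra expectation_def)
    finally show "a \<le> Re (trace (A ** tensor_op \<rho> \<sigma>))" .
  qed
  moreover have "convex {s. a \<le> Re (trace (A ** s))}"
  proof (rule convexI, simp)
    fix s t :: "complex ^ ('m \<times> 'n) ^ ('m \<times> 'n)" and c d :: real
    assume *: "a \<le> Re (trace (A ** s))" "a \<le> Re (trace (A ** t))" "0 \<le> c" "0 \<le> d" "c + d = 1"
    have lin: "Re (trace (A ** (c *\<^sub>R s + d *\<^sub>R t))) =
        c * Re (trace (A ** s)) + d * Re (trace (A ** t))"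
      by (simp add: matrix_add_ldistrib trace_add)
         (simp add: trace_def matrix_matrix_mult_def sum_distrib_left mult_ac right_diff_distrib)
    have "a = c * a + d * a"
      using *(5) by (simp flip: distrib_right)
    also have "\<dots> \<le> c * Re (trace (A ** s)) + d * Re (trace (A ** t))"
      using * by (intro add_mono mult_left_mono)
    finally show "a \<le> Re (trace (A ** (c *\<^sub>R s + d *\<^sub>R t)))"
      by (simp add: lin)
  qed
  ultimately have "separable_states \<subseteq> {s. a \<le> Re (trace (A ** s))}"
    unfolding separable_states_def by (rule hull_minimal)
  with assms(2) show ?thesis
    by blast
qed

section \<open>Orthonormal bases and the lowest eigenspace\<close>

text \<open>Orthonormality says that \<open>U ** V\<close> is the identity, where the columns of
  \<open>V\<close> are the basis vectors and \<open>U\<close> is its adjoint. For square matrices a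
  one-sided inverse is two-sided, and \<open>V ** U\<close> is the sum of the projections.\<close>

lemma orthonormal_completeness:
  fixes v :: "nat \<Rightarrow> complex ^ 'n"
  assumes "\<And>i j. i < CARD('n) \<Longrightarrow> j < CARD('n) \<Longrightarrow> cinner (v i) (v j) = (if i = j then 1 else 0)"
  shows "(\<Sum>i<CARD('n). ketbra (v i) (v i)) = mat 1"
proof -
  \<comment> \<open>The vectors are numbered by naturals but matrix columns by \<open>'n\<close>, so
    an enumeration of the type translates between them.\<close>
  obtain f :: "'n \<Rightarrow> nat" where f: "bij_betw f UNIV {..<CARD('n)}"
    using finite_same_card_bij [of "UNIV :: 'n set" "{..<CARD('n)}"] by auto
  then have flt: "f i < CARD('n)" for i
    using bij_betwE by blast
  have finj: "f i = f j \<longleftrightarrow> i = j" for i j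
    using f by (auto simp: bij_betw_def inj_on_def)
  define U :: "complex ^ 'n ^ 'n" where "U = (\<chi> i j. cnj (v (f i) $ j))"
  define V :: "complex ^ 'n ^ 'n" where "V = (\<chi> i j. v (f j) $ i)"
  have "U ** V = mat 1"
    using assms [OF flt flt]
    by (simp add: vec_eq_iff U_def V_def matrix_matrix_mult_def cinner_def mat_def finj)
  then have "V ** U = mat 1"
    by (simp add: matrix_left_right_inverse)
  moreover have "V ** U = (\<Sum>i<CARD('n). ketbra (v i) (v i))"
    by (simp add: vec_eq_iff U_def V_def matrix_matrix_mult_def ketbra_def
        sum.reindex_bij_betw [OF f, of "\<lambda>i. v i $ _ * cnj (v i $ _)"])
  ultimately show ?thesis
    by simp
qed

lemma matrix_vector_mult_sum_left:
  "(\<Sum>i\<in>I. (X i :: complex ^ 'n ^ 'n)) *v x = (\<Sum>i\<in>I. X i *v x)"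
  by (induction I rule: infinite_finite_induct) (simp_all add: matrix_vector_mult_add_rdistrib)

context
  fixes A :: "complex ^ 'n ^ 'n" and lam :: "nat \<Rightarrow> real" and v :: "nat \<Rightarrow> complex ^ 'n"
  assumes spec: "spectral_decomposition A lam v"
begin

lemma spectral_orthonormal:
  "i < CARD('n) \<Longrightarrow> j < CARD('n) \<Longrightarrow> cinner (v i) (v j) = (if i = j then 1 else 0)"
  using spec by (simp add: spectral_decomposition_def)

lemma spectral_mono: "i \<le> j \<Longrightarrow> j < CARD('n) \<Longrightarrow> lam i \<le> lam j"
  using spec by (simp add: spectral_decomposition_def)

lemma spectral_expansion: "x = (\<Sum>i<CARD('n). cinner (v i) x *s v i)"
proof -
  have "x = (\<Sum>i<CARD('n). ketbra (v i) (v i)) *v x"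
    using orthonormal_completeness [of v] spectral_orthonormal by simp
  then show ?thesis
    by (simp add: matrix_vector_mult_sum_left ketbra_vector_mult)
qed

lemma spectral_parseval: "(norm x)\<^sup>2 = (\<Sum>i<CARD('n). (cmod (cinner (v i) x))\<^sup>2)"
proof -
  have "(norm x)\<^sup>2 = expectation (mat 1) x"
    by (simp add: expectation_def cinner_self del: of_real_power)
  also have "\<dots> = expectation (\<Sum>i<CARD('n). ketbra (v i) (v i)) x"
    using orthonormal_completeness [of v] spectral_orthonormal by simp
  finally show ?thesis
    by (simp add: expectation_sum expectation_ketbra)
qed

lemma spectral_expectation:
  "expectation A x = (\<Sum>i<CARD('n). lam i * (cmod (cinner (v i) x))\<^sup>2)"
proof -
  have "A = (\<Sum>i<CARD('n). lam i *\<^sub>R ketbra (v i) (v i))"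
    using spec by (simp add: spectral_decomposition_def)
  then show ?thesis
    by (simp add: expectation_sum expectation_scaleR expectation_ketbra)
qed

lemma spectral_expectation_ge: "lam 0 * (norm x)\<^sup>2 \<le> expectation A x"
  unfolding spectral_parseval spectral_expectation sum_distrib_left
  by (intro sum_mono mult_right_mono) (auto simp: spectral_mono)

text \<open>Orthogonality to the later basis vectors is a subspace condition satisfied by the
  generators; conversely, it cuts the spectral expansion of \<open>x\<close> down to the indices up
  to \<open>k\<close>.\<close>

lemma mem_spectral_span_iff:
  assumes "k < CARD('n)"
  shows "x \<in> vec.span (v ` {0..k}) \<longleftrightarrow> (\<forall>i<CARD('n). k < i \<longrightarrow> cinner (v i) x = 0)"
proof
  assume "x \<in> vec.span (v ` {0..k})"
  moreover have "vec.subspace {x. \<forall>i<CARD('n). k < i \<longrightarrow> cinner (v i) x = 0}"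
    by (rule vec.subspaceI) (auto simp: cinner_zero_right cinner_add_right cinner_scale_right)
  moreover have "v ` {0..k} \<subseteq> {x. \<forall>i<CARD('n). k < i \<longrightarrow> cinner (v i) x = 0}"
    using assms by (auto simp: spectral_orthonormal)
  ultimately show "\<forall>i<CARD('n). k < i \<longrightarrow> cinner (v i) x = 0"
    using vec.span_minimal by blast
next
  assume *: "\<forall>i<CARD('n). k < i \<longrightarrow> cinner (v i) x = 0"
  have "(\<Sum>i<CARD('n). cinner (v i) x *s v i) \<in> vec.span (v ` {0..k})"
  proof (rule vec.span_sum)
    fix i
    assume "i \<in> {..<CARD('n)}"
    show "cinner (v i) x *s v i \<in> vec.span (v ` {0..k})"
    proof (cases "i \<le> k")
      case True
      then have "v i \<in> v ` {0..k}"
        by simp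
      then show ?thesis
        by (intro vec.span_scale vec.span_base)
    next
      case False
      then show ?thesis
        using * \<open>i \<in> {..<CARD('n)}\<close> by (simp add: vec.span_zero)
    qed
  qed
  then show "x \<in> vec.span (v ` {0..k})"
    using spectral_expansion [of x] by simp
qed

text \<open>The excess over the minimum is a sum of nonnegative terms weighted by
  \<open>lam i - lam 0\<close>, so it vanishes iff every component with a larger eigenvalue does.
  The two conditions in \<open>gap\<close> place these components exactly at the indices above
  \<open>k\<close>.\<close>

lemma expectation_eq_minimum_iff:
  assumes k: "Suc k < CARD('n)" and gap: "lam k = lam 0" "lam k < lam (Suc k)"
  shows "expectation A x = lam 0 * (norm x)\<^sup>2 \<longleftrightarrow> x \<in> vec.span (v ` {0..k})"
proof -
  have below: "lam i = lam 0" if "i \<le> k" for i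
    using spectral_mono [of 0 i] spectral_mono [of i k] that k gap(1) by simp
  have above: "lam 0 < lam i" if "k < i" "i < CARD('n)" for i
    using spectral_mono [of "Suc k" i] that gap by simp
  have "expectation A x - lam 0 * (norm x)\<^sup>2 =
      (\<Sum>i<CARD('n). (lam i - lam 0) * (cmod (cinner (v i) x))\<^sup>2)"
    by (simp add: spectral_expectation spectral_parseval sum_distrib_left sum_subtractf
        left_diff_distrib)
  then have "expectation A x = lam 0 * (norm x)\<^sup>2 \<longleftrightarrow>
      (\<Sum>i<CARD('n). (lam i - lam 0) * (cmod (cinner (v i) x))\<^sup>2) = 0"
    by linarith
  also have "\<dots> \<longleftrightarrow> (\<forall>i\<in>{..<CARD('n)}. (lam i - lam 0) * (cmod (cinner (v i) x))\<^sup>2 = 0)"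
    by (rule sum_nonneg_eq_0_iff) (auto simp: spectral_mono)
  also have "\<dots> \<longleftrightarrow> (\<forall>i<CARD('n). k < i \<longrightarrow> cinner (v i) x = 0)"
  proof -
    have "(lam i - lam 0) * (cmod (cinner (v i) x))\<^sup>2 = 0 \<longleftrightarrow> (k < i \<longrightarrow> cinner (v i) x = 0)"
      if "i < CARD('n)" for i
      using below [of i] above [of i] that by (cases "k < i") auto
    then show ?thesis
      by auto
  qed
  also have "\<dots> \<longleftrightarrow> x \<in> vec.span (v ` {0..k})"
    using k by (simp add: mem_spectral_span_iff)
  finally show ?thesis .
qed

text \<open>The bound \<open>spectral_expectation_ge\<close> is summed over the rank-one terms of
  \<open>\<rho>\<close>, whose squared norms add up to the trace 1.\<close>

lemma density_operator_trace_ge: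
  assumes "density_operator \<rho>"
  shows "lam 0 \<le> Re (trace (A ** \<rho>))"
proof -
  obtain p :: nat and w where \<rho>: "\<rho> = (\<Sum>i<p. ketbra (w i) (w i))"
    using psd_sum_ketbra assms unfolding density_operator_def by blast
  have "complex_of_real (\<Sum>i<p. (norm (w i))\<^sup>2) = 1"
    using assms by (simp add: density_operator_def \<rho> trace_sum trace_ketbra)
  then have "(\<Sum>i<p. (norm (w i))\<^sup>2) = 1"
    by (simp only: of_real_eq_1_iff)
  then have "lam 0 = (\<Sum>i<p. lam 0 * (norm (w i))\<^sup>2)"
    by (simp flip: sum_distrib_left)
  also have "\<dots> \<le> (\<Sum>i<p. expectation A (w i))"
    by (intro sum_mono spectral_expectation_ge)
  finally show ?thesis
    by (simp add: \<rho> trace_mult_sum_ketbra)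
qed

lemma spectral_minimum_attained:
  "norm (v 0) = 1" "expectation A (v 0) = lam 0"
proof -
  have card: "0 < CARD('n)"
    by simp
  have "cinner (v 0) (v 0) = 1"
    using spectral_orthonormal [OF card card] by simp
  then have "(norm (v 0))\<^sup>2 = 1"
    by (simp only: cinner_self of_real_eq_1_iff)
  then show "norm (v 0) = 1"
    by (simp add: power2_eq_1_iff) (use norm_ge_zero [of "v 0"] in linarith)
  have "expectation A (v 0) = (\<Sum>i<CARD('n). if i = 0 then lam 0 else 0)"
    unfolding spectral_expectation
    by (intro sum.cong) (auto simp: spectral_orthonormal)
  then show "expectation A (v 0) = lam 0"
    by simp
qed

end

section \<open>Left witnesses\<close>

text \<open>For the forward direction, \<open>k\<close> is the last index carrying the least
  eigenvalue. For the converse any admissible \<open>k\<close> will do, since the gap after it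
  forces its span to contain the whole lowest eigenspace.\<close>

lemma left_witness_iff_span:
  fixes A :: "complex ^ ('m::finite \<times> 'n::finite) ^ ('m \<times> 'n)"
  assumes spec: "spectral_decomposition A lam v"
  shows "left_witness A \<longleftrightarrow>
    (\<exists>k. Suc k < CARD('m \<times> 'n) \<and>
      \<not> (\<exists>\<psi>\<in>vec.span (v ` {0..k}). separable_pure_state \<psi>) \<and> lam k < lam (Suc k))"
    (is "_ \<longleftrightarrow> (\<exists>k. ?P k)")
proof
  assume "left_witness A"
  then obtain a \<rho> where sep: "separable_states \<inter> open_halfspace A a = {}"
    and \<rho>: "density_operator \<rho>" "Re (trace (A ** \<rho>)) < a"
    by (auto simp: left_witness_def entangled_states_def open_halfspace_def)
  \<comment> \<open>The chain is: \<open>lam 0\<close> is at most the value at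
    \<open>\<rho>\<close>, which lies below \<open>a\<close>, which is at most the value at any
    separable pure state.\<close>
  have less: "lam 0 < expectation A \<psi>" if "separable_pure_state \<psi>" for \<psi>
  proof -
    have "\<not> expectation A \<psi> < a"
      using sep ketbra_separable_pure_state [OF that] hermitian_ketbra [of \<psi>]
      by (auto simp: open_halfspace_def trace_mult_ketbra expectation_def)
    then show ?thesis
      using density_operator_trace_ge [OF spec \<rho>(1)] \<rho>(2) by simp
  qed
  let ?nonmin = "\<lambda>i. i < CARD('m \<times> 'n) \<and> lam i \<noteq> lam 0"
  have "\<exists>i. ?nonmin i"
  proof (rule ccontr)
    assume "\<not> ?thesis"
    then have const: "lam i = lam 0" if "i < CARD('m \<times> 'n)" for i
      using that by blast
    \<comment> \<open>With a single eigenvalue every unit vector attains \<open>lam 0\<close>; a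
      product basis vector, at an arbitrary index, contradicts \<open>less\<close>.\<close>
    define \<psi> :: "complex ^ ('m \<times> 'n)" where
      "\<psi> = tensor_vec (axis undefined 1) (axis undefined 1)"
    have "norm \<psi> = 1"
      by (simp add: \<psi>_def norm_tensor_vec)
    then have "separable_pure_state \<psi>"
      by (auto simp: separable_pure_state_def \<psi>_def)
    moreover have "expectation A \<psi> = lam 0 * (norm \<psi>)\<^sup>2"
      unfolding spectral_expectation [OF spec] spectral_parseval [OF spec] sum_distrib_left
    proof (intro sum.cong refl)
      fix i
      assume "i \<in> {..<CARD('m \<times> 'n)}"
      then have "lam i = lam 0"
        using const [of i] by blast
      then show "lam i * (cmod (cinner (v i) \<psi>))\<^sup>2 = lam 0 * (cmod (cinner (v i) \<psi>))\<^sup>2"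
        by (rule arg_cong)
    qed
    ultimately show False
      using less [of \<psi>] \<open>norm \<psi> = 1\<close> by simp
  qed
  then have "?nonmin (LEAST i. ?nonmin i)"
    by (rule LeastI_ex)
  moreover define j where "j = (LEAST i. ?nonmin i)"
  ultimately have j: "j < CARD('m \<times> 'n)" "lam j \<noteq> lam 0"
    by simp_all
  have least: "\<not> ?nonmin i" if "i < j" for i
    using not_less_Least that unfolding j_def by blast
  \<comment> \<open>The first index with a nonminimal eigenvalue is not 0, so it has a predecessor,
    which by leastness still carries \<open>lam 0\<close>.\<close>
  obtain k where k: "j = Suc k"
    using j(2) by (cases j) auto
  have eq: "lam k = lam 0"
    using least [of k] j k by simp
  have gap: "lam k < lam (Suc k)"
    using spectral_mono [OF spec, of k "Suc k"] eq j k by simp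
  have "\<not> separable_pure_state \<psi>" if "\<psi> \<in> vec.span (v ` {0..k})" for \<psi>
  proof
    assume sp: "separable_pure_state \<psi>"
    have "expectation A \<psi> = lam 0 * (norm \<psi>)\<^sup>2"
      using expectation_eq_minimum_iff [OF spec _ eq gap, of \<psi>] j(1) k that by simp
    then show False
      using less [OF sp] sp by (simp add: separable_pure_state_def)
  qed
  then show "\<exists>k. ?P k"
    using j(1) k gap by blast
next
  assume "\<exists>k. ?P k"
  then obtain k where k: "Suc k < CARD('m \<times> 'n)" "lam k < lam (Suc k)"
    and nosep: "\<And>\<psi>. \<psi> \<in> vec.span (v ` {0..k}) \<Longrightarrow> \<not> separable_pure_state \<psi>"
    by blast
  \<comment> \<open>Here \<open>lam k\<close> itself may exceed \<open>lam 0\<close>; the gap after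
    \<open>k\<close> and monotonicity still separate all later eigenvalues from
    \<open>lam 0\<close>.\<close>
  have above: "lam 0 < lam i" if "k < i" "i < CARD('m \<times> 'n)" for i
    using spectral_mono [OF spec, of "Suc k" i] spectral_mono [OF spec, of 0 k] that k by simp
  have less: "lam 0 < expectation A \<psi>" if sp: "separable_pure_state \<psi>" for \<psi>
  proof -
    have unit: "norm \<psi> = 1"
      using sp by (simp add: separable_pure_state_def)
    have "\<psi> \<notin> vec.span (v ` {0..k})"
      using nosep sp by blast
    \<comment> \<open>A nonzero component beyond \<open>k\<close> makes one summand of the
      comparison with \<open>lam 0\<close> strict.\<close>
    then obtain i where i: "i < CARD('m \<times> 'n)" "k < i" "cinner (v i) \<psi> \<noteq> 0"
      using mem_spectral_span_iff [OF spec, of k \<psi>] k(1) by auto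
    have "lam 0 * (norm \<psi>)\<^sup>2 < expectation A \<psi>"
      unfolding spectral_expectation [OF spec] spectral_parseval [OF spec] sum_distrib_left
    proof (rule sum_strict_mono_ex1)
      show "\<forall>i\<in>{..<CARD('m \<times> 'n)}. lam 0 * (cmod (cinner (v i) \<psi>))\<^sup>2
          \<le> lam i * (cmod (cinner (v i) \<psi>))\<^sup>2"
        using spectral_mono [OF spec, of 0] by (auto intro: mult_right_mono)
      show "\<exists>i\<in>{..<CARD('m \<times> 'n)}. lam 0 * (cmod (cinner (v i) \<psi>))\<^sup>2
          < lam i * (cmod (cinner (v i) \<psi>))\<^sup>2"
        using i above by (intro bexI [of _ i] mult_strict_right_mono) auto
    qed simp
    then show ?thesis
      by (simp add: unit)
  qed
  \<comment> \<open>Each expectation exceeds \<open>lam 0\<close>, but a threshold needs a uniform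
    gap. Compactness supplies it: the minimum is attained, hence is itself above
    \<open>lam 0\<close>.\<close>
  let ?S = "sphere (0 :: complex ^ 'm) 1 \<times> sphere (0 :: complex ^ 'n) 1"
  have "compact ?S"
    by (intro compact_Times compact_sphere)
  moreover have "(axis undefined 1, axis undefined 1) \<in> ?S"
    by simp
  ultimately obtain p where p: "p \<in> ?S"
    and min: "\<And>q. q \<in> ?S \<Longrightarrow>
      expectation A (tensor_vec (fst p) (snd p)) \<le> expectation A (tensor_vec (fst q) (snd q))"
    using continuous_attains_inf [OF _ _ continuous_on_tensor_expectation [of ?S A]] by blast
  define a where "a = expectation A (tensor_vec (fst p) (snd p))"
  have "separable_pure_state (tensor_vec (fst p) (snd p))"
    using p by (auto simp: separable_pure_state_def norm_tensor_vec)
  then have a: "lam 0 < a"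
    unfolding a_def by (rule less)
  have sep: "a \<le> Re (trace (A ** s))" if "s \<in> separable_states" for s
    using that
  proof (rule trace_mult_separable_ge [rotated])
    fix x :: "complex ^ 'm" and y :: "complex ^ 'n"
    assume "norm x = 1" "norm y = 1"
    then show "a \<le> expectation A (tensor_vec x y)"
      using min [of "(x, y)"] by (simp add: a_def)
  qed
  \<comment> \<open>The lowest eigenstate has value \<open>lam 0 < a\<close>, while separable states
    have values at least \<open>a\<close>; hence it is entangled.\<close>
  let ?\<rho> = "ketbra (v 0) (v 0)"
  have val: "Re (trace (A ** ?\<rho>)) < a"
    using spectral_minimum_attained [OF spec] a by (simp add: trace_mult_ketbra expectation_def)
  then have "?\<rho> \<in> entangled_states \<inter> open_halfspace A a"
    using sep [of ?\<rho>] spectral_minimum_attained [OF spec]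
    by (auto simp: entangled_states_def open_halfspace_def density_operator_ketbra
        hermitian_ketbra)
  moreover have "separable_states \<inter> open_halfspace A a = {}"
    using sep by (force simp: open_halfspace_def)
  ultimately show "left_witness A"
    unfolding left_witness_def by blast
qed

section \<open>Right witnesses by negation and index reversal\<close>

lemma right_witness_iff_left_witness_uminus: "right_witness A \<longleftrightarrow> left_witness (- A)"
proof
  assume "right_witness A"
  then show "left_witness (- A)"
    unfolding right_witness_def left_witness_def by blast
next
  assume "left_witness (- A)"
  \<comment> \<open>The threshold for the right witness is \<open>b = - a\<close>, so
    \<open>a\<close> is written as \<open>- (- a)\<close> to match the definition.\<close>
  then obtain a where "separable_states \<inter> open_halfspace (- A) (- (- a)) = {}"
    "entangled_states \<inter> open_halfspace (- A) (- (- a)) \<noteq> {}"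
    unfolding left_witness_def by auto
  then show "right_witness A"
    unfolding right_witness_def by blast
qed

text \<open>Negation turns the order of the eigenvalues around; running through the indices
  backwards makes them nondecreasing again.\<close>

lemma spectral_decomposition_uminus:
  fixes A :: "complex ^ 'n ^ 'n"
  assumes "spectral_decomposition A lam v"
  shows "spectral_decomposition (- A)
    (\<lambda>i. - lam (CARD('n) - Suc i)) (\<lambda>i. v (CARD('n) - Suc i))"
proof -
  have "- A = (\<Sum>i<CARD('n). - lam i *\<^sub>R ketbra (v i) (v i))"
    using assms by (simp add: spectral_decomposition_def sum_negf)
  also have "\<dots> = (\<Sum>i<CARD('n). - lam (CARD('n) - Suc i) *\<^sub>R
      ketbra (v (CARD('n) - Suc i)) (v (CARD('n) - Suc i)))"
    by (rule sum.nat_diff_reindex [symmetric])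
  finally have sum: "- A = \<dots>" .
  have "\<forall>i<CARD('n). \<forall>j<CARD('n).
      cinner (v (CARD('n) - Suc i)) (v (CARD('n) - Suc j)) = (if i = j then 1 else 0)"
    using assms by (auto simp: spectral_decomposition_def)
  moreover have "- lam (CARD('n) - Suc i) \<le> - lam (CARD('n) - Suc j)"
    if "i \<le> j \<and> j < CARD('n)" for i j
  proof -
    have "CARD('n) - Suc j \<le> CARD('n) - Suc i \<and> CARD('n) - Suc i < CARD('n)"
      using that by auto
    then show ?thesis
      using assms unfolding spectral_decomposition_def neg_le_iff_le by blast
  qed
  ultimately show ?thesis
    unfolding spectral_decomposition_def using sum by blast
qed

text \<open>The map sending \<open>i\<close> to \<open>d - Suc i\<close> is an involution on the
  indices below \<open>d\<close>, so it carries initial segments to final ones.\<close>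

lemma image_reverse_interval:
  assumes "k < (d::nat)"
  shows "(\<lambda>i. v (d - Suc i)) ` {0..k} = v ` {d - Suc k..d - 1}"
proof -
  have "(\<lambda>i. d - Suc i) ` {0..k} = {d - Suc k..d - 1}"
  proof (intro equalityI subsetI)
    fix j
    assume "j \<in> {d - Suc k..d - 1}"
    then have "j = d - Suc (d - Suc j)" "d - Suc j \<in> {0..k}"
      using assms by auto
    then show "j \<in> (\<lambda>i. d - Suc i) ` {0..k}"
      by (rule image_eqI)
  qed (use assms in auto)
  moreover have "(\<lambda>i. v (d - Suc i)) ` {0..k} = v ` ((\<lambda>i. d - Suc i) ` {0..k})"
    by (simp only: image_image)
  ultimately show ?thesis
    by simp
qed

theorem theorem2p1:
  fixes A :: "complex ^ ('m::finite \<times> 'n::finite) ^ ('m \<times> 'n)"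
    and lam :: "nat \<Rightarrow> real"
    and v :: "nat \<Rightarrow> complex ^ ('m \<times> 'n)"
    and M N :: nat
  assumes "M = CARD('m)" and "N = CARD('n)"
    and "M \<ge> 2" and "N \<ge> 2"
    and "hermitian A"
    and "spectral_decomposition A lam v"
  shows "left_witness A \<or> right_witness A \<longleftrightarrow>
    (\<exists>k\<in>{0..M * N - 2}.
        \<not> (\<exists>\<psi>\<in>vec.span (v ` {0..k}). separable_pure_state \<psi>) \<and> lam (k + 1) > lam k) \<or>
    (\<exists>l\<in>{1..M * N - 1}.
        \<not> (\<exists>\<psi>\<in>vec.span (v ` {l..M * N - 1}). separable_pure_state \<psi>) \<and> lam l > lam (l - 1))"
proof -
  define D where "D = M * N"
  have card: "CARD('m \<times> 'n) = D"
    using assms(1,2) by (simp add: D_def)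
  have "2 * 2 \<le> D"
    unfolding D_def using assms(3,4) by (rule mult_le_mono)
  then have D: "2 \<le> D"
    by simp
  have left: "left_witness A \<longleftrightarrow> (\<exists>k\<in>{0..D - 2}.
      \<not> (\<exists>\<psi>\<in>vec.span (v ` {0..k}). separable_pure_state \<psi>) \<and> lam (k + 1) > lam k)"
  proof -
    \<comment> \<open>Subtraction on naturals is truncated; \<open>2 \<le> D\<close> ensures that
      \<open>D - 2\<close> is the true difference.\<close>
    have "Suc k < D \<longleftrightarrow> k \<in> {0..D - 2}" for k
      using D by auto
    then show ?thesis
      unfolding left_witness_iff_span [OF assms(6)] card by auto
  qed
  have "right_witness A \<longleftrightarrow> (\<exists>k. Suc k < D \<and>
      \<not> (\<exists>\<psi>\<in>vec.span ((\<lambda>i. v (D - Suc i)) ` {0..k}). separable_pure_state \<psi>) \<and>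
      - lam (D - Suc k) < - lam (D - Suc (Suc k)))"
    unfolding right_witness_iff_left_witness_uminus
      left_witness_iff_span [OF spectral_decomposition_uminus [OF assms(6)]] card ..
  also have "\<dots> \<longleftrightarrow> (\<exists>l\<in>{1..D - 1}.
      \<not> (\<exists>\<psi>\<in>vec.span (v ` {l..D - 1}). separable_pure_state \<psi>) \<and> lam l > lam (l - 1))"
    (is "(\<exists>k. ?P k) \<longleftrightarrow> (\<exists>l\<in>_. ?Q l)")
  proof -
    \<comment> \<open>Under \<open>l = D - Suc k\<close> the negated gap becomes
      \<open>lam (l - 1) < lam l\<close>, because \<open>D - Suc (Suc k)\<close> is
      \<open>l - 1\<close>.\<close>
    have PQ: "?P k \<longleftrightarrow> ?Q (D - Suc k)" if "Suc k < D" for k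
      using that image_reverse_interval [of k D v] by simp
    show ?thesis
    proof
      assume "\<exists>k. ?P k"
      then obtain k where k: "?P k"
        by blast
      then have "?Q (D - Suc k)"
        using PQ by blast
      moreover have "D - Suc k \<in> {1..D - 1}"
        using k by auto
      ultimately show "\<exists>l\<in>{1..D - 1}. ?Q l"
        by blast
    next
      assume "\<exists>l\<in>{1..D - 1}. ?Q l"
      then obtain l where l: "l \<in> {1..D - 1}" "?Q l"
        by blast
      \<comment> \<open>The substitution is its own inverse, and \<open>1 \<le> l\<close> keeps the
        successor of the resulting index below \<open>D\<close>.\<close>
      then have "Suc (D - Suc l) < D" "D - Suc (D - Suc l) = l"
        by auto
      with l(2) have "?P (D - Suc l)"
        using PQ [of "D - Suc l"] by simp
      then show "\<exists>k. ?P k"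
        by blast
    qed
  qed
  finally show ?thesis
    using left by (simp add: D_def)
qed

end
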